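(* Let $\rho$ be a two-qubit density matrix, and let $A,B$ be complex $2\times2$ matrices with $A^\dagger A\le I_2$, $B^\dagger B\le I_2$, $\det(A)\neq0$, $\det(B)\neq 0$. Let $$\rho'=\frac{(A\otimes B)\rho(A\otimes B)^\dagger}{\operatorname{Tr}\left((A\otimes B)\rho(A\otimes B)^\dagger\right)},$$ and let $R$ and $R'$ be the real $4\times4$ matrices with elements $R_{ij}=\frac12\operatorname{Tr}(\rho(\sigma_i\otimes\sigma_j))$ and $R'_{ij}=\frac12\operatorname{Tr}(\rho'(\sigma_i\otimes\sigma_j))$, $i,j\in\{0,1,2,3\}$. Then, up to normalization (that is, up to multiplication by a positive scalar), $$R'=L_A\,R\,L_B^T,$$ where $$L_A=\frac{T(A\otimes A^* )T^\dagger}{|\det(A)|},\qquad L_B=\frac{T(B\otimes B^* )T^\dagger}{|\det(B)|},\qquad T=\frac{1}{\sqrt2}\begin{pmatrix}1&0&0&1\\0&1&1&0\\0&i&-i&0\\1&0&0&-1\end{pmatrix},$$ and $L_A$ and $L_B$ are proper orthochronous Lorentz transformations.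
   Context: A two-qubit density matrix is a positive semidefinite complex $4\times4$ matrix on $\mathbb{C}^2\otimes\mathbb{C}^2$ of trace one. $\sigma_0=I_2$ and $\sigma_1=\begin{pmatrix}0&1\\1&0\end{pmatrix}$, $\sigma_2=\begin{pmatrix}0&-i\\i&0\end{pmatrix}$, $\sigma_3=\begin{pmatrix}1&0\\0&-1\end{pmatrix}$ are the Pauli matrices. $A^*$ is the entrywise complex conjugate, $^T$ the transpose, $^\dagger$ the conjugate transpose, and $\otimes$ is the Kronecker product in the standard (lexicographically ordered) basis. With $M=\operatorname{diag}[1,-1,-1,-1]$, a proper orthochronous Lorentz transformation is a real $4\times4$ matrix $L$ (indices $0,\dots,3$) with $LML^T=M$, $\det L=1$ and $L_{00}>0$. *)

theory Defs
  imports "Jordan_Normal_Form.Schur_Decomposition"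
begin

definition mat_trace :: "'a :: comm_monoid_add mat \<Rightarrow> 'a" where
  "mat_trace A = (\<Sum>i<dim_row A. A $$ (i, i))"

(* The row and column index pairs of the factors are ordered lexicographically. *)
definition kron :: "'a :: times mat \<Rightarrow> 'a mat \<Rightarrow> 'a mat" (infixl \<open>\<otimes>\<^sub>K\<close> 72) where
  "A \<otimes>\<^sub>K B = mat (dim_row A * dim_row B) (dim_col A * dim_col B)
     (\<lambda>(i, j). A $$ (i div dim_row B, j div dim_col B) * B $$ (i mod dim_row B, j mod dim_col B))"

(* The order on complex from HOL-Library.Complex_Order makes 0 \<le> z say that z is real and
   nonnegative; (A *\<^sub>v v) \<bullet>c v is v^\<dagger> A v. *)
definition psd :: "nat \<Rightarrow> complex mat \<Rightarrow> bool" where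
  "psd n A \<longleftrightarrow> A \<in> carrier_mat n n \<and> mat_adjoint A = A \<and>
     (\<forall>v \<in> carrier_vec n. 0 \<le> (A *\<^sub>v v) \<bullet>c v)"

(* The order of the class instance for matrices is entrywise, hence not usable here. *)
definition loewner_le :: "nat \<Rightarrow> complex mat \<Rightarrow> complex mat \<Rightarrow> bool" where
  "loewner_le n A B \<longleftrightarrow> A \<in> carrier_mat n n \<and> B \<in> carrier_mat n n \<and> psd n (B - A)"

definition two_qubit_density :: "complex mat \<Rightarrow> bool" where
  "two_qubit_density \<rho> \<longleftrightarrow> psd 4 \<rho> \<and> mat_trace \<rho> = 1"

definition pauli :: "nat \<Rightarrow> complex mat" where
  "pauli i =
     [1\<^sub>m 2,
      mat_of_rows_list 2 [[0, 1], [1, 0]],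
      mat_of_rows_list 2 [[0, - \<i>], [\<i>, 0]],
      mat_of_rows_list 2 [[1, 0], [0, - 1]]] ! i"

(* Complex-valued, as the trace is; that the entries are real is a claim. *)
definition pauli_coeffs :: "complex mat \<Rightarrow> complex mat" where
  "pauli_coeffs \<rho> = mat 4 4 (\<lambda>(i, j). 1 / 2 * mat_trace (\<rho> * (pauli i \<otimes>\<^sub>K pauli j)))"

definition minkowski :: "real mat" where
  "minkowski = mat_diag 4 (\<lambda>i. if i = 0 then 1 else - 1)"

definition proper_orthochronous_lorentz :: "real mat \<Rightarrow> bool" where
  "proper_orthochronous_lorentz L \<longleftrightarrow> L \<in> carrier_mat 4 4 \<and>
     L * minkowski * transpose_mat L = minkowski \<and> det L = 1 \<and> 0 < L $$ (0, 0)"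

definition T_mat :: "complex mat" where
  "T_mat = (1 / complex_of_real (sqrt 2)) \<cdot>\<^sub>m mat_of_rows_list 4
     [[1, 0, 0, 1],
      [0, 1, 1, 0],
      [0, \<i>, - \<i>, 0],
      [1, 0, 0, - 1]]"

definition lorentz_of :: "complex mat \<Rightarrow> complex mat" where
  "lorentz_of A = (1 / complex_of_real (cmod (det A))) \<cdot>\<^sub>m
     (T_mat * (A \<otimes>\<^sub>K map_mat cnj A) * mat_adjoint T_mat)"

end

theory Submission
  imports Defs
begin

text \<open>
  The rows of \<open>T\<close> are the flattened matrices \<open>\<sigma>\<^sub>i\<^sup>T\<close> divided by \<open>\<surd>2\<close>, so
  \<open>N(A) = T (A \<otimes> A\<^sup>*) T\<^sup>\<dagger>\<close> has the entries
  \<open>Tr (\<sigma>\<^sub>i A \<sigma>\<^sub>k A\<^sup>\<dagger>) / 2\<close>: it is real, its corner entry is positive, and expanding in the Pauli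
  basis gives \<open>A\<^sup>\<dagger> \<sigma>\<^sub>i A = \<Sum>\<^sub>k N(A)\<^sub>i\<^sub>k \<sigma>\<^sub>k\<close>. By cyclicity of the trace, conjugating \<open>\<rho>\<close> with
  \<open>A \<otimes> B\<close> therefore turns \<open>R\<close> into \<open>N(A) R N(B)\<^sup>T\<close>. The Minkowski form is
  \<open>M = T (\<epsilon> \<otimes> \<epsilon>) T\<^sup>T\<close> with \<open>\<epsilon>\<close> the symplectic form on \<open>\<complex>\<^sup>2\<close>, and
  \<open>A \<epsilon> A\<^sup>T = det A \<cdot> \<epsilon>\<close>; hence \<open>N(A)\<close> preserves \<open>M\<close> up to the factor \<open>|det A|\<^sup>2\<close>. The
  normalizing trace is positive because a positive semidefinite matrix of trace zero vanishes
  and \<open>A \<otimes> B\<close> is invertible.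
\<close>

section \<open>Kronecker products, adjoints and traces\<close>

text \<open>Division with remainder, \<open>k = i * n + j\<close>, is the lexicographic numbering of
  index pairs, so sums over a Kronecker index split over its factors.\<close>

lemma sum_lessThan_mult:
  fixes f :: "nat \<Rightarrow> 'a :: comm_monoid_add"
  shows "(\<Sum>k<m * n. f k) = (\<Sum>i<m. \<Sum>j<n. f (i * n + j))"
  unfolding sum.nat_group[symmetric]
  by (rule sum.cong[OF refl], subst sum.atLeastLessThan_shift_0) (simp add: lessThan_atLeast0)

lemma sum_rotate:
  "(\<Sum>a\<in>A. \<Sum>b\<in>B. \<Sum>c\<in>C. f a b c) = (\<Sum>b\<in>B. \<Sum>c\<in>C. \<Sum>a\<in>A. f a b c)"
  by (simp add: sum.swap[of _ A B] sum.swap[of _ A C])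

text \<open>Entries as sums over \<open>{..<m}\<close> can be split, swapped and evaluated. The
  default rule \<open>index_mult_mat(1)\<close> produces scalar products instead, and several calls
  below switch it off.\<close>

lemma index_mult_mat_sum:
  assumes "A \<in> carrier_mat n m" "B \<in> carrier_mat m p" "i < n" "j < p"
  shows "(A * B) $$ (i, j) = (\<Sum>k<m. A $$ (i, k) * B $$ (k, j))"
  using assms by (simp add: scalar_prod_def lessThan_atLeast0)

lemma kron_carrier [simp, intro]:
  "A \<in> carrier_mat n m \<Longrightarrow> B \<in> carrier_mat p q \<Longrightarrow> A \<otimes>\<^sub>K B \<in> carrier_mat (n * p) (m * q)"
  by (auto simp: kron_def)

text \<open>The product \<open>2 * 2\<close> in the conclusion of \<open>kron_carrier\<close> does
  not unify with the literal \<open>4\<close>.\<close>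

lemma kron_carrier_4 [simp, intro]:
  "A \<in> carrier_mat 2 2 \<Longrightarrow> B \<in> carrier_mat 2 2 \<Longrightarrow> A \<otimes>\<^sub>K B \<in> carrier_mat 4 4"
  using kron_carrier[of A 2 2 B 2 2] by simp

lemma dim_kron [simp]:
  "dim_row (A \<otimes>\<^sub>K B) = dim_row A * dim_row B" "dim_col (A \<otimes>\<^sub>K B) = dim_col A * dim_col B"
  by (auto simp: kron_def)

lemma index_kron:
  assumes "A \<in> carrier_mat n m" "B \<in> carrier_mat p q" "i < n * p" "j < m * q"
  shows "(A \<otimes>\<^sub>K B) $$ (i, j) = A $$ (i div p, j div q) * B $$ (i mod p, j mod q)"
  using assms by (auto simp: kron_def)

text \<open>With the inner index written as \<open>s * q + t\<close>, each summand is a term in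
  \<open>s\<close> times a term in \<open>t\<close>, so the double sum is the product of two matrix
  entries.\<close>

lemma kron_mult:
  fixes A B C D :: "'a :: comm_semiring_0 mat"
  assumes A: "A \<in> carrier_mat n m" and C: "C \<in> carrier_mat m l"
    and B: "B \<in> carrier_mat p q" and D: "D \<in> carrier_mat q r"
  shows "(A \<otimes>\<^sub>K B) * (C \<otimes>\<^sub>K D) = (A * C) \<otimes>\<^sub>K (B * D)"
proof (rule eq_matI)
  fix i j assume "i < dim_row ((A * C) \<otimes>\<^sub>K (B * D))" "j < dim_col ((A * C) \<otimes>\<^sub>K (B * D))"
  then have i: "i < n * p" and j: "j < l * r" using assms by auto
  have ip: "i div p < n" "i mod p < p" and jr: "j div r < l" "j mod r < r"
    using i j by (auto simp: less_mult_imp_div_less intro!: mod_less_divisor intro: gr0I)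
  have *: "(A \<otimes>\<^sub>K B) $$ (i, s * q + t) * (C \<otimes>\<^sub>K D) $$ (s * q + t, j) =
      (A $$ (i div p, s) * C $$ (s, j div r)) * (B $$ (i mod p, t) * D $$ (t, j mod r))"
    if "s < m" "t < q" for s t
  proof -
    have "s * q + t < m * q"
      using that mult_le_mono1[of "Suc s" m q] by simp
    then show ?thesis
      using index_kron[OF A B i] index_kron[OF C D _ j] that by (simp add: mult_ac)
  qed
  have "((A \<otimes>\<^sub>K B) * (C \<otimes>\<^sub>K D)) $$ (i, j) =
      (\<Sum>s<m. \<Sum>t<q. (A \<otimes>\<^sub>K B) $$ (i, s * q + t) * (C \<otimes>\<^sub>K D) $$ (s * q + t, j))"
    by (simp only: index_mult_mat_sum[OF kron_carrier[OF A B] kron_carrier[OF C D] i j]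
        sum_lessThan_mult)
  also have "\<dots> = (\<Sum>s<m. \<Sum>t<q. (A $$ (i div p, s) * C $$ (s, j div r)) *
      (B $$ (i mod p, t) * D $$ (t, j mod r)))"
    using * by simp
  also have "\<dots> = (A * C) $$ (i div p, j div r) * (B * D) $$ (i mod p, j mod r)"
    unfolding index_mult_mat_sum[OF A C ip(1) jr(1)] index_mult_mat_sum[OF B D ip(2) jr(2)]
    by (simp add: sum_product)
  also have "\<dots> = ((A * C) \<otimes>\<^sub>K (B * D)) $$ (i, j)"
    using index_kron[OF mult_carrier_mat[OF A C] mult_carrier_mat[OF B D] i j] by simp
  finally show "((A \<otimes>\<^sub>K B) * (C \<otimes>\<^sub>K D)) $$ (i, j) = ((A * C) \<otimes>\<^sub>K (B * D)) $$ (i, j)" .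
qed (use assms in auto)

lemma kron_transpose:
  "transpose_mat (A \<otimes>\<^sub>K B) = transpose_mat A \<otimes>\<^sub>K transpose_mat B"
proof (rule eq_matI)
  fix i j assume "i < dim_row (transpose_mat A \<otimes>\<^sub>K transpose_mat B)"
    "j < dim_col (transpose_mat A \<otimes>\<^sub>K transpose_mat B)"
  then have i: "i < dim_col A * dim_col B" and j: "j < dim_row A * dim_row B" by auto
  \<comment> \<open>An index in range forces nonempty factors, which the bounds on
    \<open>mod\<close> require.\<close>
  then have "0 < dim_col B" "0 < dim_row B" by (auto intro: gr0I)
  with i j show "transpose_mat (A \<otimes>\<^sub>K B) $$ (i, j) = (transpose_mat A \<otimes>\<^sub>K transpose_mat B) $$ (i, j)"
    by (simp add: kron_def less_mult_imp_div_less)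
qed auto

lemma mat_adjoint_index [simp]:
  "i < dim_col A \<Longrightarrow> j < dim_row A \<Longrightarrow> mat_adjoint A $$ (i, j) = conjugate (A $$ (j, i))"
  "dim_row (mat_adjoint A) = dim_col A" "dim_col (mat_adjoint A) = dim_row A"
  by (auto simp: mat_adjoint_def mat_of_rows_def)

lemma mat_adjoint_carrier [simp, intro]:
  "A \<in> carrier_mat n m \<Longrightarrow> mat_adjoint A \<in> carrier_mat m n"
  by auto

lemma mat_adjoint_adjoint [simp]: "mat_adjoint (mat_adjoint A) = A"
  by (rule eq_matI) auto

lemma mat_adjoint_mult:
  fixes A B :: "complex mat"
  assumes A: "A \<in> carrier_mat n m" and B: "B \<in> carrier_mat m p"
  shows "mat_adjoint (A * B) = mat_adjoint B * mat_adjoint A"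
proof (rule eq_matI)
  fix i j assume "i < dim_row (mat_adjoint B * mat_adjoint A)" "j < dim_col (mat_adjoint B * mat_adjoint A)"
  then have i: "i < p" and j: "j < n" using A B by auto
  show "mat_adjoint (A * B) $$ (i, j) = (mat_adjoint B * mat_adjoint A) $$ (i, j)"
    using A B i j index_mult_mat_sum[OF A B j i]
      index_mult_mat_sum[OF mat_adjoint_carrier[OF B] mat_adjoint_carrier[OF A] i j]
    by (simp add: mult.commute)
qed (use A B in auto)

lemma mat_adjoint_kron:
  fixes A B :: "complex mat"
  shows "mat_adjoint (A \<otimes>\<^sub>K B) = mat_adjoint A \<otimes>\<^sub>K mat_adjoint B"
proof (rule eq_matI)
  fix i j assume "i < dim_row (mat_adjoint A \<otimes>\<^sub>K mat_adjoint B)"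
    "j < dim_col (mat_adjoint A \<otimes>\<^sub>K mat_adjoint B)"
  then have i: "i < dim_col A * dim_col B" and j: "j < dim_row A * dim_row B" by auto
  then have "0 < dim_col B" "0 < dim_row B" by (auto intro: gr0I)
  with i j show "mat_adjoint (A \<otimes>\<^sub>K B) $$ (i, j) = (mat_adjoint A \<otimes>\<^sub>K mat_adjoint B) $$ (i, j)"
    by (simp add: kron_def less_mult_imp_div_less)
qed auto

lemma mat_trace_mult_commute:
  fixes A B :: "'a :: comm_semiring_0 mat"
  assumes A: "A \<in> carrier_mat n m" and B: "B \<in> carrier_mat m n"
  shows "mat_trace (A * B) = mat_trace (B * A)"
proof -
  have "mat_trace (A * B) = (\<Sum>i<n. \<Sum>k<m. A $$ (i, k) * B $$ (k, i))"
    using A index_mult_mat_sum[OF A B] by (simp add: mat_trace_def)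
  also have "\<dots> = (\<Sum>k<m. \<Sum>i<n. B $$ (k, i) * A $$ (i, k))"
    by (subst sum.swap) (simp add: mult.commute)
  also have "\<dots> = mat_trace (B * A)"
    using B index_mult_mat_sum[OF B A] by (simp add: mat_trace_def)
  finally show ?thesis .
qed

lemma mat_trace_adjoint:
  "A \<in> carrier_mat n n \<Longrightarrow> mat_trace (mat_adjoint A) = cnj (mat_trace A)"
  by (auto simp: mat_trace_def)

text \<open>Conjugating the trace of \<open>A * B\<close> gives the trace of the adjoint, which is
  \<open>B * A\<close>; cyclicity returns the original value.\<close>

lemma mat_trace_hermitian_mult_real:
  fixes A B :: "complex mat"
  assumes "A \<in> carrier_mat n n" "B \<in> carrier_mat n n"
    and "mat_adjoint A = A" "mat_adjoint B = B"
  shows "mat_trace (A * B) \<in> \<real>"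
proof -
  have "cnj (mat_trace (A * B)) = mat_trace (A * B)"
    using assms mat_trace_adjoint[of "A * B" n] mat_adjoint_mult[of A n n B n]
      mat_trace_mult_commute[of A n n B] by simp
  then show ?thesis by (simp add: Reals_cnj_iff)
qed

lemma mat_trace_smult:
  fixes A :: "'a :: semiring_0 mat"
  assumes "A \<in> carrier_mat n n"
  shows "mat_trace (c \<cdot>\<^sub>m A) = c * mat_trace A"
  using assms by (simp add: mat_trace_def sum_distrib_left)

section \<open>Small determinants\<close>

lemma lessThan_2_3_4:
  "{..<2 :: nat} = {0, 1}" "{..<3 :: nat} = {0, 1, 2}" "{..<4 :: nat} = {0, 1, 2, 3}"
  by auto

lemma less_4_cases: "(i :: nat) < 4 \<longleftrightarrow> i = 0 \<or> i = 1 \<or> i = 2 \<or> i = 3"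
  by auto

lemma det_mat_2:
  assumes A: "A \<in> carrier_mat 2 2"
  shows "det A = A $$ (0, 0) * A $$ (1, 1) - A $$ (0, 1) * A $$ (1, 0)"
proof -
  have c: "mat_delete A 0 j \<in> carrier_mat 1 1" for j
    using mat_delete_carrier[OF A] by simp
  \<comment> \<open>\<open>mat_delete\<close> stays folded in the first call, so that the rule for
    the smaller determinant can fire; the second call evaluates the entries.\<close>
  show ?thesis
    using A by (simp add: laplace_expansion_row[OF A, of 0] lessThan_2_3_4 cofactor_def det_single[OF c])
      (simp add: mat_delete_def)
qed

lemma det_mat_3:
  assumes A: "A \<in> carrier_mat 3 3"
  shows "det A = A $$ (0, 0) * (A $$ (1, 1) * A $$ (2, 2) - A $$ (1, 2) * A $$ (2, 1))
    - A $$ (0, 1) * (A $$ (1, 0) * A $$ (2, 2) - A $$ (1, 2) * A $$ (2, 0))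
    + A $$ (0, 2) * (A $$ (1, 0) * A $$ (2, 1) - A $$ (1, 1) * A $$ (2, 0))"
proof -
  have c: "mat_delete A 0 j \<in> carrier_mat 2 2" for j
    using mat_delete_carrier[OF A] by simp
  have e: "Suc (Suc 0) = 2" by simp
  show ?thesis
    using A by (simp add: laplace_expansion_row[OF A, of 0] lessThan_2_3_4 cofactor_def det_mat_2[OF c])
      (simp add: mat_delete_def e algebra_simps)
qed

lemma det_kron_2:
  fixes A B :: "'a :: comm_ring_1 mat"
  assumes A: "A \<in> carrier_mat 2 2" and B: "B \<in> carrier_mat 2 2"
  shows "det (A \<otimes>\<^sub>K B) = (det A)\<^sup>2 * (det B)\<^sup>2"
proof -
  \<comment> \<open>Factoring as \<open>(A \<otimes> I) (I \<otimes> B)\<close> keeps the Laplace expansions sparse.\<close>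
  let ?I = "1\<^sub>m 2 :: 'a mat"
  have I: "?I \<in> carrier_mat 2 2" by simp
  have AI: "A \<otimes>\<^sub>K ?I \<in> carrier_mat 4 4" and IB: "?I \<otimes>\<^sub>K B \<in> carrier_mat 4 4" using A B by auto
  have c: "X \<in> carrier_mat 4 4 \<Longrightarrow> mat_delete X 0 j \<in> carrier_mat 3 3" for X :: "'a mat" and j
    using mat_delete_carrier[of X 4 4] by simp
  have e: "Suc (Suc 0) = 2" "Suc 2 = 3" by simp_all
  have "det (A \<otimes>\<^sub>K ?I) = (det A)\<^sup>2"
    using AI A by (simp add: laplace_expansion_row[OF AI, of 0] lessThan_2_3_4 cofactor_def
        det_mat_3[OF c[OF AI]] det_mat_2[OF A])
      (simp add: mat_delete_def e index_kron[OF A I] algebra_simps power2_eq_square)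
  moreover have "det (?I \<otimes>\<^sub>K B) = (det B)\<^sup>2"
    using IB B by (simp add: laplace_expansion_row[OF IB, of 0] lessThan_2_3_4 cofactor_def
        det_mat_3[OF c[OF IB]] det_mat_2[OF B])
      (simp add: mat_delete_def e index_kron[OF I B] algebra_simps power2_eq_square)
  moreover have "A \<otimes>\<^sub>K B = (A \<otimes>\<^sub>K ?I) * (?I \<otimes>\<^sub>K B)"
    using A B by (simp add: kron_mult[of _ 2 2 _ 2 _ 2 2 _ 2])
  ultimately show ?thesis
    using det_mult[OF AI IB] by simp
qed

section \<open>The Pauli basis and the spinor map\<close>

lemma pauli_carrier [simp, intro]: "i < 4 \<Longrightarrow> pauli i \<in> carrier_mat 2 2"
  by (auto simp: less_4_cases pauli_def mat_of_rows_list_def numeral_3_eq_3)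

lemma dim_pauli [simp]: "i < 4 \<Longrightarrow> dim_row (pauli i) = 2" "i < 4 \<Longrightarrow> dim_col (pauli i) = 2"
  using pauli_carrier by blast+

lemma pauli_index:
  "pauli 0 $$ (0, 0) = 1" "pauli 0 $$ (0, 1) = 0" "pauli 0 $$ (1, 0) = 0" "pauli 0 $$ (1, 1) = 1"
  "pauli 1 $$ (0, 0) = 0" "pauli 1 $$ (0, 1) = 1" "pauli 1 $$ (1, 0) = 1" "pauli 1 $$ (1, 1) = 0"
  "pauli 2 $$ (0, 0) = 0" "pauli 2 $$ (0, 1) = - \<i>" "pauli 2 $$ (1, 0) = \<i>" "pauli 2 $$ (1, 1) = 0"
  "pauli 3 $$ (0, 0) = 1" "pauli 3 $$ (0, 1) = 0" "pauli 3 $$ (1, 0) = 0" "pauli 3 $$ (1, 1) = - 1"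
  by (auto simp: pauli_def mat_of_rows_list_def numeral_3_eq_3 numeral_2_eq_2)

lemma pauli_cnj:
  "i < 4 \<Longrightarrow> p < 2 \<Longrightarrow> q < 2 \<Longrightarrow> cnj (pauli i $$ (p, q)) = pauli i $$ (q, p)"
  \<comment> \<open>Simplification turns the index \<open>1\<close> into \<open>Suc 0\<close>, hence
    the table in both forms.\<close>
  by (auto simp: less_4_cases less_2_cases_iff pauli_index[unfolded One_nat_def] pauli_index)

lemma pauli_hermitian: "i < 4 \<Longrightarrow> mat_adjoint (pauli i) = pauli i"
  by (rule eq_matI) (auto simp: pauli_cnj)

text \<open>The Pauli matrices divided by the square root of 2 are an orthonormal basis for the
  trace inner product. For the four entries the expansion is checked directly.\<close>

lemma pauli_expansion:
  assumes X: "X \<in> carrier_mat 2 2" and p: "p < 2" and q: "q < 2"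
  shows "X $$ (p, q) = (\<Sum>k<4. 1 / 2 * mat_trace (pauli k * X) * pauli k $$ (p, q))"
proof -
  have "mat_trace (pauli k * X) = (\<Sum>a<2. \<Sum>b<2. pauli k $$ (a, b) * X $$ (b, a))" if "k < 4" for k
    using that pauli_carrier[of k] X index_mult_mat_sum[OF pauli_carrier X, of k]
    by (simp add: mat_trace_def)
  then show ?thesis
    using p q by (auto simp: lessThan_2_3_4 less_2_cases_iff pauli_index[unfolded One_nat_def] pauli_index field_simps)
qed

section \<open>The change of basis \<open>T_mat\<close> and the unnormalized Lorentz map\<close>

lemma T_mat_carrier [simp, intro]: "T_mat \<in> carrier_mat 4 4"
  by (auto simp: T_mat_def mat_of_rows_list_def)

lemma dim_T_mat [simp]: "dim_row T_mat = 4" "dim_col T_mat = 4"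
  using T_mat_carrier by blast+

text \<open>The pair \<open>(p div 2, p mod 2)\<close> occurs swapped because the rows are
  transposed Pauli matrices; only the antisymmetric \<open>pauli 2\<close> notices.\<close>

lemma T_mat_index:
  "i < 4 \<Longrightarrow> p < 4 \<Longrightarrow>
    T_mat $$ (i, p) = 1 / complex_of_real (sqrt 2) * pauli i $$ (p mod 2, p div 2)"
  by (auto simp: less_4_cases T_mat_def mat_of_rows_list_def pauli_index[unfolded One_nat_def]
      pauli_index numeral_3_eq_3[symmetric] numeral_2_eq_2[symmetric])

lemma half_sqrt_2: "1 / complex_of_real (sqrt 2) * (1 / complex_of_real (sqrt 2)) = 1 / 2"
  by (simp flip: of_real_mult)

text \<open>The numerator of \<open>lorentz_of\<close>. Its entries are sums of products of entries
  of \<open>A\<close> and their conjugates; the division by the modulus of \<open>det A\<close> is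
  postponed to the end.\<close>

definition spinor_map :: "complex mat \<Rightarrow> complex mat" where
  "spinor_map A = T_mat * (A \<otimes>\<^sub>K map_mat cnj A) * mat_adjoint T_mat"

lemma spinor_map_carrier [simp, intro]: "A \<in> carrier_mat 2 2 \<Longrightarrow> spinor_map A \<in> carrier_mat 4 4"
  by (rule carrier_matI) (auto simp: spinor_map_def)

text \<open>On row-wise flattened matrices, \<open>A\<close> tensor its conjugate acts as X
  \<mapsto> A X A\<dagger>. Column \<open>k\<close> of the adjoint of \<open>T_mat\<close> is the
  flattened \<open>pauli k\<close>, and pairing with row \<open>i\<close> of \<open>T_mat\<close> is
  the trace against \<open>pauli i\<close>, both up to the factors giving 1/2.\<close>

lemma spinor_map_index:
  assumes A: "A \<in> carrier_mat 2 2" and i: "i < 4" and k: "k < 4"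
  shows "spinor_map A $$ (i, k) = 1 / 2 * mat_trace (pauli i * (A * pauli k * mat_adjoint A))"
proof -
  let ?K = "A \<otimes>\<^sub>K map_mat cnj A"
  have K: "?K \<in> carrier_mat 4 4" and A': "map_mat cnj A \<in> carrier_mat 2 2" using A by auto
  have term_eq: "T_mat $$ (i, p) * ?K $$ (p, q) * cnj (T_mat $$ (k, q)) =
      1 / 2 * (pauli i $$ (p mod 2, p div 2) * (A $$ (p div 2, q div 2) * cnj (A $$ (p mod 2, q mod 2)))
        * pauli k $$ (q div 2, q mod 2))" if p: "p < 4" and q: "q < 4" for p q
  proof -
    \<comment> \<open>Both normalizing factors are collected in the exact shape of
      \<open>half_sqrt_2\<close>; \<open>pauli_cnj\<close> removes the conjugate by swapping the
      indices of \<open>pauli k\<close>.\<close>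
    have "T_mat $$ (i, p) * ?K $$ (p, q) * cnj (T_mat $$ (k, q)) =
      (1 / complex_of_real (sqrt 2) * (1 / complex_of_real (sqrt 2))) *
       (pauli i $$ (p mod 2, p div 2) * (A $$ (p div 2, q div 2) * cnj (A $$ (p mod 2, q mod 2)))
        * pauli k $$ (q div 2, q mod 2))"
      using p q A i k by (simp add: T_mat_index index_kron[OF A A'] pauli_cnj less_mult_imp_div_less)
    then show ?thesis by (simp only: half_sqrt_2)
  qed
  have AP: "A * pauli k \<in> carrier_mat 2 2" and P: "A * pauli k * mat_adjoint A \<in> carrier_mat 2 2"
    using A k by auto
  have "spinor_map A $$ (i, k) = (\<Sum>q<4. (T_mat * ?K) $$ (i, q) * mat_adjoint T_mat $$ (q, k))"
    unfolding spinor_map_def using K i k by (intro index_mult_mat_sum[of _ 4 4]) (auto intro: mult_carrier_mat)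
  also have "\<dots> = (\<Sum>q<4. \<Sum>p<4. T_mat $$ (i, p) * ?K $$ (p, q) * cnj (T_mat $$ (k, q)))"
    using carrier_matD[OF T_mat_carrier] k
    by (simp add: index_mult_mat_sum[OF T_mat_carrier K i] sum_distrib_right)
  also have "\<dots> = (\<Sum>q<4. \<Sum>p<4. 1 / 2 * (pauli i $$ (p mod 2, p div 2) *
      (A $$ (p div 2, q div 2) * cnj (A $$ (p mod 2, q mod 2))) * pauli k $$ (q div 2, q mod 2)))"
    by (simp add: term_eq)
  \<comment> \<open>Reindexing by \<open>p = 2 * b + a\<close> and
    \<open>q = 2 * c + d\<close>.\<close>
  also have "\<dots> = 1 / 2 * (\<Sum>a<2. \<Sum>b<2. pauli i $$ (a, b) *
      (\<Sum>d<2. (\<Sum>c<2. A $$ (b, c) * pauli k $$ (c, d)) * cnj (A $$ (a, d))))"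
    by (simp add: lessThan_2_3_4 algebra_simps)
  also have "\<dots> = 1 / 2 * mat_trace (pauli i * (A * pauli k * mat_adjoint A))"
    using A i k carrier_matD[OF pauli_carrier[OF i]]
    by (simp add: mat_trace_def index_mult_mat_sum[OF pauli_carrier[OF i] P]
        index_mult_mat_sum[OF AP mat_adjoint_carrier[OF A]]
        index_mult_mat_sum[OF A pauli_carrier[OF k]] del: index_mult_mat(1))
  finally show ?thesis .
qed

section \<open>Pauli coefficients under local operations\<close>

lemma mat_trace_mult_kron:
  fixes X Y :: "'a :: comm_semiring_0 mat"
  assumes "\<rho> \<in> carrier_mat 4 4" and X: "X \<in> carrier_mat 2 2" and Y: "Y \<in> carrier_mat 2 2"
  shows "mat_trace (\<rho> * (X \<otimes>\<^sub>K Y)) =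
    (\<Sum>i<4. \<Sum>j<4. \<rho> $$ (i, j) * (X $$ (j div 2, i div 2) * Y $$ (j mod 2, i mod 2)))"
  using assms index_mult_mat_sum[OF assms(1) kron_carrier_4[OF X Y]]
  by (simp add: mat_trace_def index_kron[OF X Y])

text \<open>\<open>pauli_expansion\<close> gives the coefficients as half traces of
  \<open>pauli k\<close> against A\<dagger> \<sigma> A with \<sigma> = \<open>pauli i\<close>;
  cyclicity moves the conjugation onto \<open>pauli k\<close>, where it is an entry of
  \<open>spinor_map A\<close>.\<close>

lemma pauli_conjugation:
  assumes A: "A \<in> carrier_mat 2 2" and i: "i < 4" and p: "p < 2" and q: "q < 2"
  shows "(mat_adjoint A * pauli i * A) $$ (p, q) = (\<Sum>k<4. spinor_map A $$ (i, k) * pauli k $$ (p, q))"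
proof -
  have "mat_trace (pauli k * (mat_adjoint A * pauli i * A)) =
      mat_trace (pauli i * (A * pauli k * mat_adjoint A))" if k: "k < 4" for k
  proof -
    note c = A mat_adjoint_carrier[OF A] pauli_carrier[OF i] pauli_carrier[OF k]
    have "mat_trace (pauli k * (mat_adjoint A * pauli i * A)) =
        mat_trace ((pauli k * mat_adjoint A) * (pauli i * A))"
      using c by (simp add: assoc_mult_mat[of _ 2 2 _ 2 _ 2] mult_carrier_mat[of _ 2 2 _ 2])
    also have "\<dots> = mat_trace ((pauli i * A) * (pauli k * mat_adjoint A))"
      using c by (intro mat_trace_mult_commute[of _ 2 2]) auto
    also have "\<dots> = mat_trace (pauli i * (A * pauli k * mat_adjoint A))"
      using c by (simp add: assoc_mult_mat[of _ 2 2 _ 2 _ 2] mult_carrier_mat[of _ 2 2 _ 2])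
    finally show ?thesis .
  qed
  then show ?thesis
    using A i p q pauli_expansion[of "mat_adjoint A * pauli i * A" p q]
    by (simp add: spinor_map_index mult_carrier_mat[of _ 2 2 _ 2])
qed

lemma pauli_coeffs_conjugation:
  assumes \<rho>: "\<rho> \<in> carrier_mat 4 4" and A: "A \<in> carrier_mat 2 2" and B: "B \<in> carrier_mat 2 2"
  shows "pauli_coeffs ((A \<otimes>\<^sub>K B) * \<rho> * mat_adjoint (A \<otimes>\<^sub>K B)) =
    spinor_map A * pauli_coeffs \<rho> * transpose_mat (spinor_map B)"
proof (rule eq_matI)
  let ?C = "A \<otimes>\<^sub>K B" and ?R = "pauli_coeffs \<rho>"
  have R: "?R \<in> carrier_mat 4 4" by (simp add: pauli_coeffs_def)
  fix i j assume "i < dim_row (spinor_map A * ?R * transpose_mat (spinor_map B))"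
    "j < dim_col (spinor_map A * ?R * transpose_mat (spinor_map B))"
  then have i: "i < 4" and j: "j < 4"
    using carrier_matD[OF spinor_map_carrier[OF A]] carrier_matD[OF spinor_map_carrier[OF B]] by auto
  let ?X = "mat_adjoint A * pauli i * A" and ?Y = "mat_adjoint B * pauli j * B"
  have X: "?X \<in> carrier_mat 2 2" and Y: "?Y \<in> carrier_mat 2 2" using A B i j by auto
  have C: "?C \<in> carrier_mat 4 4" and C': "mat_adjoint ?C \<in> carrier_mat 4 4"
    and S: "pauli i \<otimes>\<^sub>K pauli j \<in> carrier_mat 4 4"
    using A B i j by (auto intro!: mat_adjoint_carrier)
  let ?a = "spinor_map A" and ?b = "spinor_map B"
  \<comment> \<open>Cyclicity moves the conjugation from the state to the observable, where it acts
    on each tensor factor separately.\<close>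
  have "mat_trace (?C * \<rho> * mat_adjoint ?C * (pauli i \<otimes>\<^sub>K pauli j)) =
      mat_trace (?C * (\<rho> * (mat_adjoint ?C * (pauli i \<otimes>\<^sub>K pauli j))))"
    using C C' S \<rho> by (simp add: assoc_mult_mat[of _ 4 4 _ 4 _ 4] mult_carrier_mat[of _ 4 4 _ 4])
  also have "\<dots> = mat_trace ((\<rho> * (mat_adjoint ?C * (pauli i \<otimes>\<^sub>K pauli j))) * ?C)"
    using C C' S \<rho> by (intro mat_trace_mult_commute[of _ 4 4]) (auto simp: mult_carrier_mat[of _ 4 4 _ 4])
  also have "\<dots> = mat_trace (\<rho> * (mat_adjoint ?C * (pauli i \<otimes>\<^sub>K pauli j) * ?C))"
    using C C' S \<rho> by (simp add: assoc_mult_mat[of _ 4 4 _ 4 _ 4] mult_carrier_mat[of _ 4 4 _ 4])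
  also have "mat_adjoint ?C * (pauli i \<otimes>\<^sub>K pauli j) * ?C = ?X \<otimes>\<^sub>K ?Y"
    unfolding mat_adjoint_kron
    using A B i j by (simp add: kron_mult[of _ 2 2 _ 2 _ 2 2 _ 2] mult_carrier_mat[of _ 2 2 _ 2])
  also have "mat_trace (\<rho> * (?X \<otimes>\<^sub>K ?Y)) = (\<Sum>p<4. \<Sum>q<4. \<rho> $$ (p, q) * (\<Sum>k<4. \<Sum>l<4.
      (?a $$ (i, k) * pauli k $$ (q div 2, p div 2)) * (?b $$ (j, l) * pauli l $$ (q mod 2, p mod 2))))"
    unfolding mat_trace_mult_kron[OF \<rho> X Y]
    by (intro sum.cong refl)
      (simp add: pauli_conjugation[OF A i] pauli_conjugation[OF B j] sum_product less_mult_imp_div_less)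
  \<comment> \<open>Two rotations carry first \<open>q\<close>, then \<open>p\<close>, inside the
    sums over \<open>k\<close> and \<open>l\<close>, where they reassemble to a trace.\<close>
  also have "\<dots> = (\<Sum>p<4. \<Sum>k<4. \<Sum>l<4. \<Sum>q<4. \<rho> $$ (p, q) *
      ((?a $$ (i, k) * pauli k $$ (q div 2, p div 2)) * (?b $$ (j, l) * pauli l $$ (q mod 2, p mod 2))))"
    unfolding sum_distrib_left by (rule sum.cong[OF refl], rule sum_rotate)
  also have "\<dots> = (\<Sum>k<4. \<Sum>l<4. \<Sum>p<4. \<Sum>q<4. \<rho> $$ (p, q) *
      ((?a $$ (i, k) * pauli k $$ (q div 2, p div 2)) * (?b $$ (j, l) * pauli l $$ (q mod 2, p mod 2))))"
    by (rule sum_rotate)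
  also have "\<dots> = (\<Sum>k<4. \<Sum>l<4. ?a $$ (i, k) * mat_trace (\<rho> * (pauli k \<otimes>\<^sub>K pauli l)) * ?b $$ (j, l))"
    by (intro sum.cong refl)
      (simp add: mat_trace_mult_kron[OF \<rho>] sum_distrib_left sum_distrib_right mult_ac)
  \<comment> \<open>So far the bare trace was computed; its prefactor in \<open>pauli_coeffs\<close>
    enters here and is absorbed into \<open>?R\<close>.\<close>
  also have "1 / 2 * \<dots> = (\<Sum>l<4. (\<Sum>k<4. ?a $$ (i, k) * ?R $$ (k, l)) * ?b $$ (j, l))"
    by (subst sum.swap) (simp add: pauli_coeffs_def sum_distrib_left sum_distrib_right mult_ac)
  also have "\<dots> = (?a * ?R * transpose_mat ?b) $$ (i, j)"
    using spinor_map_carrier[OF A] spinor_map_carrier[OF B] R i j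
    by (simp add: index_mult_mat_sum[of _ 4 4 _ 4] mult_carrier_mat[of _ 4 4 _ 4]
        del: index_mult_mat(1) assoc_mult_mat)
  finally show "pauli_coeffs (?C * \<rho> * mat_adjoint ?C) $$ (i, j) =
      (?a * ?R * transpose_mat ?b) $$ (i, j)"
    using i j by (simp add: pauli_coeffs_def)
qed (use spinor_map_carrier[OF A] spinor_map_carrier[OF B] in \<open>auto simp: pauli_coeffs_def\<close>)

section \<open>The Lorentz property\<close>

text \<open>The entries of the first product are half the traces of products of two Pauli matrices,
  so this is their orthogonality.\<close>

lemma T_mat_unitary: "T_mat * mat_adjoint T_mat = 1\<^sub>m 4" "mat_adjoint T_mat * T_mat = 1\<^sub>m 4"
proof -
  show *: "T_mat * mat_adjoint T_mat = 1\<^sub>m 4"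
  proof (rule eq_matI)
    fix i k assume "i < dim_row (1\<^sub>m 4 :: complex mat)" "k < dim_col (1\<^sub>m 4 :: complex mat)"
    then have i: "i < 4" and k: "k < 4" by auto
    have "(T_mat * mat_adjoint T_mat) $$ (i, k) = (\<Sum>p<4. T_mat $$ (i, p) * cnj (T_mat $$ (k, p)))"
      using index_mult_mat_sum[OF T_mat_carrier mat_adjoint_carrier[OF T_mat_carrier] i k] k by simp
    also have "\<dots> = (\<Sum>p<4. (1 / complex_of_real (sqrt 2) * (1 / complex_of_real (sqrt 2))) *
        (pauli i $$ (p mod 2, p div 2) * pauli k $$ (p div 2, p mod 2)))"
      using i k by (intro sum.cong refl) (simp add: T_mat_index pauli_cnj less_mult_imp_div_less)
    also have "\<dots> = 1\<^sub>m 4 $$ (i, k)"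
      using i k unfolding half_sqrt_2
      by (auto simp: lessThan_2_3_4 less_4_cases pauli_index[unfolded One_nat_def] pauli_index)
    finally show "(T_mat * mat_adjoint T_mat) $$ (i, k) = 1\<^sub>m 4 $$ (i, k)" .
  qed auto
  show "mat_adjoint T_mat * T_mat = 1\<^sub>m 4"
    by (rule mat_mult_left_right_inverse[OF _ _ *]) auto
qed

section \<open>The symplectic form and the Minkowski form\<close>

definition eps_mat :: "complex mat" where
  "eps_mat = mat_of_rows_list 2 [[0, 1], [- 1, 0]]"

lemma eps_mat_carrier [simp, intro]: "eps_mat \<in> carrier_mat 2 2"
  by (auto simp: eps_mat_def mat_of_rows_list_def)

lemma eps_mat_index:
  "eps_mat $$ (0, 0) = 0" "eps_mat $$ (0, 1) = 1" "eps_mat $$ (1, 0) = - 1" "eps_mat $$ (1, 1) = 0"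
  by (auto simp: eps_mat_def mat_of_rows_list_def)

text \<open>Congruence preserves antisymmetry, and antisymmetric 2 by 2 matrices are multiples of
  \<epsilon>; the upper right entry of the result is the determinant.\<close>

lemma eps_mat_conjugation:
  assumes A: "A \<in> carrier_mat 2 2"
  shows "A * eps_mat * transpose_mat A = det A \<cdot>\<^sub>m eps_mat"
proof (rule eq_matI)
  fix i j assume "i < dim_row (det A \<cdot>\<^sub>m eps_mat)" "j < dim_col (det A \<cdot>\<^sub>m eps_mat)"
  then have i: "i < 2" and j: "j < 2" using carrier_matD[OF eps_mat_carrier] by auto
  have AE: "A * eps_mat \<in> carrier_mat 2 2" and A': "transpose_mat A \<in> carrier_mat 2 2"
    using A by auto
  have "(A * eps_mat * transpose_mat A) $$ (i, j) =
      (\<Sum>l<2. (\<Sum>k<2. A $$ (i, k) * eps_mat $$ (k, l)) * A $$ (j, l))"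
    using A j by (simp add: index_mult_mat_sum[OF AE A' i j] index_mult_mat_sum[OF A eps_mat_carrier i]
        del: index_mult_mat(1))
  then show "(A * eps_mat * transpose_mat A) $$ (i, j) = (det A \<cdot>\<^sub>m eps_mat) $$ (i, j)"
    using i j carrier_matD[OF eps_mat_carrier]
    by (auto simp: lessThan_2_3_4 less_2_cases_iff det_mat_2[OF A]
        eps_mat_index[unfolded One_nat_def] eps_mat_index)
qed (use A carrier_matD[OF eps_mat_carrier] in auto)

lemma minkowski_carrier [simp, intro]: "minkowski \<in> carrier_mat 4 4"
  by (simp add: minkowski_def)

text \<open>Here T is transposed without conjugation, as the form is bilinear. Entry
  \<open>(i, k)\<close> is half the trace of \<open>pauli i\<close> times \<epsilon> X \<epsilon>^T,
  with X the transpose of \<open>pauli k\<close>. This conjugation yields the adjugate of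
  \<open>pauli k\<close>: it fixes the identity and negates the other three, and orthogonality does
  the rest.\<close>

lemma T_mat_eps:
  "T_mat * (eps_mat \<otimes>\<^sub>K eps_mat) * transpose_mat T_mat = map_mat complex_of_real minkowski"
proof (rule eq_matI)
  let ?J = "eps_mat \<otimes>\<^sub>K eps_mat"
  fix i k assume "i < dim_row (map_mat complex_of_real minkowski)"
    "k < dim_col (map_mat complex_of_real minkowski)"
  then have i: "i < 4" and k: "k < 4" by (auto simp: minkowski_def mat_diag_def)
  have J: "?J \<in> carrier_mat 4 4" and TJ: "T_mat * ?J \<in> carrier_mat 4 4"
    and T': "transpose_mat T_mat \<in> carrier_mat 4 4"
    using T_mat_carrier by (auto intro!: mult_carrier_mat[of _ 4 4])
  have "(T_mat * ?J * transpose_mat T_mat) $$ (i, k) =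
      (\<Sum>q<4. \<Sum>p<4. T_mat $$ (i, p) * ?J $$ (p, q) * T_mat $$ (k, q))"
    using k by (simp add: index_mult_mat_sum[OF TJ T' i k] index_mult_mat_sum[OF T_mat_carrier J i]
        sum_distrib_right del: index_mult_mat(1))
  also have "\<dots> = (\<Sum>q<4. \<Sum>p<4. (1 / complex_of_real (sqrt 2) * (1 / complex_of_real (sqrt 2))) *
        (pauli i $$ (p mod 2, p div 2) * (eps_mat $$ (p div 2, q div 2) * eps_mat $$ (p mod 2, q mod 2))
          * pauli k $$ (q mod 2, q div 2)))"
    using i k by (intro sum.cong refl)
      (simp add: T_mat_index index_kron[OF eps_mat_carrier eps_mat_carrier])
  also have "\<dots> = map_mat complex_of_real minkowski $$ (i, k)"
    using i k unfolding half_sqrt_2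
    by (auto simp: lessThan_2_3_4 less_4_cases minkowski_def mat_diag_def
        eps_mat_index[unfolded One_nat_def] eps_mat_index
        pauli_index[unfolded One_nat_def] pauli_index)
  finally show "(T_mat * ?J * transpose_mat T_mat) $$ (i, k) = map_mat complex_of_real minkowski $$ (i, k)" .
qed (auto simp: minkowski_def mat_diag_def)

lemma det_map_cnj:
  "A \<in> carrier_mat 2 2 \<Longrightarrow> det (map_mat cnj A) = cnj (det A)"
  by (simp add: det_mat_2[of A] det_mat_2[of "map_mat cnj A"])

section \<open>Scalar multiples, determinant and Lorentz relation\<close>

lemma transpose_smult_mat: "transpose_mat (c \<cdot>\<^sub>m A) = c \<cdot>\<^sub>m transpose_mat A"
  by (rule eq_matI) auto

lemma smult_smult_mat: "a \<cdot>\<^sub>m (b \<cdot>\<^sub>m A) = (a * b) \<cdot>\<^sub>m (A :: 'a :: semigroup_mult mat)"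
  by (rule eq_matI) (auto simp: mult.assoc)

lemma one_smult_mat [simp]: "1 \<cdot>\<^sub>m A = (A :: 'a :: monoid_mult mat)"
  by (rule eq_matI) auto

lemma map_mat_of_real_smult:
  "map_mat complex_of_real (c \<cdot>\<^sub>m A) = complex_of_real c \<cdot>\<^sub>m map_mat complex_of_real A"
  by (rule eq_matI) auto

lemma kron_smult_smult:
  fixes A B :: "'a :: comm_semiring_0 mat"
  assumes A: "A \<in> carrier_mat n m" and B: "B \<in> carrier_mat p q"
  shows "(a \<cdot>\<^sub>m A) \<otimes>\<^sub>K (b \<cdot>\<^sub>m B) = (a * b) \<cdot>\<^sub>m (A \<otimes>\<^sub>K B)"
proof (rule eq_matI)
  fix i j assume "i < dim_row ((a * b) \<cdot>\<^sub>m (A \<otimes>\<^sub>K B))" "j < dim_col ((a * b) \<cdot>\<^sub>m (A \<otimes>\<^sub>K B))"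
  then have i: "i < n * p" and j: "j < m * q" using A B by auto
  then have "0 < p" "0 < q" by (auto intro: gr0I)
  with i j show "((a \<cdot>\<^sub>m A) \<otimes>\<^sub>K (b \<cdot>\<^sub>m B)) $$ (i, j) = ((a * b) \<cdot>\<^sub>m (A \<otimes>\<^sub>K B)) $$ (i, j)"
    using A B by (simp add: kron_def less_mult_imp_div_less mult_ac)
qed auto

text \<open>The Lorentz relation alone fixes the determinant only up to sign. Here the unitary
  factors cancel, and the value is exactly what scaling a 4 by 4 matrix by the inverse modulus of
  \<open>det A\<close> removes.\<close>

lemma det_spinor_map:
  assumes A: "A \<in> carrier_mat 2 2"
  shows "det (spinor_map A) = (complex_of_real (cmod (det A))) ^ 4"
proof -
  let ?K = "A \<otimes>\<^sub>K map_mat cnj A"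
  have K: "?K \<in> carrier_mat 4 4" using A by simp
  have T': "mat_adjoint T_mat \<in> carrier_mat 4 4" by auto
  have "det (spinor_map A) = det T_mat * det ?K * det (mat_adjoint T_mat)"
    unfolding spinor_map_def
    using det_mult[OF mult_carrier_mat[OF T_mat_carrier K] T'] det_mult[OF T_mat_carrier K] by simp
  also have "\<dots> = det ?K * det (T_mat * mat_adjoint T_mat)"
    using det_mult[OF T_mat_carrier T'] by simp
  also have "\<dots> = (det A * cnj (det A))\<^sup>2"
    using A by (simp add: T_mat_unitary det_kron_2 det_map_cnj power_mult_distrib)
  also have "\<dots> = (complex_of_real (cmod (det A))) ^ 4"
    by (simp flip: complex_norm_square)
  finally show ?thesis .
qed

lemma spinor_map_minkowski:
  assumes A: "A \<in> carrier_mat 2 2"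
  shows "spinor_map A * map_mat complex_of_real minkowski * transpose_mat (spinor_map A) =
    (complex_of_real (cmod (det A)))\<^sup>2 \<cdot>\<^sub>m map_mat complex_of_real minkowski"
proof -
  let ?B = "map_mat cnj A" and ?J = "eps_mat \<otimes>\<^sub>K eps_mat" and ?T' = "mat_adjoint T_mat"
  let ?K = "A \<otimes>\<^sub>K ?B"
  have B: "?B \<in> carrier_mat 2 2" using A by simp
  have c: "?K \<in> carrier_mat 4 4" "?J \<in> carrier_mat 4 4" "T_mat \<in> carrier_mat 4 4" "?T' \<in> carrier_mat 4 4"
    "transpose_mat ?K \<in> carrier_mat 4 4" "transpose_mat T_mat \<in> carrier_mat 4 4"
    "transpose_mat ?T' \<in> carrier_mat 4 4"
    using A by (auto intro!: kron_carrier_4)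
  note assoc = assoc_mult_mat[of _ 4 4 _ 4 _ 4] mult_carrier_mat[of _ 4 4 _ 4]
  have TT: "transpose_mat T_mat * transpose_mat ?T' = 1\<^sub>m 4"
    using transpose_mult[OF c(4) c(3)] by (simp add: T_mat_unitary)
  \<comment> \<open>The cancellations carry a trailing factor \<open>X\<close> because
    \<open>assoc\<close> brackets all products to the right.\<close>
  have TTX: "transpose_mat T_mat * (transpose_mat ?T' * X) = X" "?T' * (T_mat * X) = X"
    if "X \<in> carrier_mat 4 4" for X
    using that c by (simp_all flip: assoc_mult_mat[of _ 4 4 _ 4 _ 4] add: TT T_mat_unitary)
  have "?K * ?J * transpose_mat ?K = (A * eps_mat * transpose_mat A) \<otimes>\<^sub>K (?B * eps_mat * transpose_mat ?B)"
    using A B by (simp add: kron_transpose kron_mult[of _ 2 2 _ 2 _ 2 2 _ 2] mult_carrier_mat[of _ 2 2 _ 2])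
  also have "\<dots> = (det A * cnj (det A)) \<cdot>\<^sub>m ?J"
    using A B by (simp add: eps_mat_conjugation det_map_cnj kron_smult_smult[of _ 2 2 _ 2 2])
  finally have KJ: "?K * (?J * transpose_mat ?K) = (complex_of_real (cmod (det A)))\<^sup>2 \<cdot>\<^sub>m ?J"
    using c by (simp add: assoc flip: complex_norm_square)
  have S': "transpose_mat (spinor_map A) = transpose_mat ?T' * (transpose_mat ?K * transpose_mat T_mat)"
    using c unfolding spinor_map_def
    by (simp add: transpose_mult[of _ 4 4 _ 4] mult_carrier_mat[of _ 4 4 _ 4])
  have "spinor_map A * map_mat complex_of_real minkowski * transpose_mat (spinor_map A) =
      T_mat * (?K * (?J * transpose_mat ?K)) * transpose_mat T_mat"
    unfolding S' T_mat_eps[symmetric] unfolding spinor_map_def using c by (simp add: assoc TTX)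
  also have "\<dots> = (complex_of_real (cmod (det A)))\<^sup>2 \<cdot>\<^sub>m (T_mat * ?J * transpose_mat T_mat)"
    unfolding KJ using c
    by (simp add: mult_smult_distrib[of _ 4 4 _ 4] mult_smult_assoc_mat[of _ 4 4 _ 4]
        mult_carrier_mat[of _ 4 4 _ 4])
  finally show ?thesis unfolding T_mat_eps .
qed

section \<open>Reality, orientation of time and normalization\<close>

lemma map_mat_of_real_Re:
  assumes "\<And>i j. i < dim_row X \<Longrightarrow> j < dim_col X \<Longrightarrow> X $$ (i, j) \<in> \<real>"
  shows "map_mat complex_of_real (map_mat Re X) = X"
  using assms by (intro eq_matI) auto

lemma spinor_map_real:
  assumes A: "A \<in> carrier_mat 2 2" and i: "i < 4" and k: "k < 4"
  shows "spinor_map A $$ (i, k) \<in> \<real>"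
proof -
  have "mat_adjoint (A * pauli k * mat_adjoint A) = A * pauli k * mat_adjoint A"
    using A k by (simp add: mat_adjoint_mult[of _ 2 2 _ 2] pauli_hermitian
        assoc_mult_mat[of _ 2 2 _ 2 _ 2] mult_carrier_mat[of _ 2 2 _ 2])
  then have "mat_trace (pauli i * (A * pauli k * mat_adjoint A)) \<in> \<real>"
    using A i k by (intro mat_trace_hermitian_mult_real[of _ 2])
      (auto simp: pauli_hermitian mult_carrier_mat[of _ 2 2 _ 2])
  then show ?thesis
    using A i k by (simp add: spinor_map_index Reals_divide)
qed

text \<open>As \<open>pauli 0\<close> is the identity, the corner entry is half the squared
  Frobenius norm of \<open>A\<close>.\<close>

lemma spinor_map_00_pos:
  assumes A: "A \<in> carrier_mat 2 2" and det: "det A \<noteq> 0"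
  shows "0 < Re (spinor_map A $$ (0, 0))"
proof -
  have "Re (spinor_map A $$ (0, 0)) = 1 / 2 * (\<Sum>a<2. \<Sum>b<2. (cmod (A $$ (a, b)))\<^sup>2)"
  proof -
    have "pauli 0 = 1\<^sub>m 2" by (simp add: pauli_def)
    then have "Re (spinor_map A $$ (0, 0)) = 1 / 2 * Re (mat_trace (A * mat_adjoint A))"
      using A by (simp add: spinor_map_index left_mult_one_mat[of _ 2 2] mult_carrier_mat[of _ 2 2 _ 2])
    also have "mat_trace (A * mat_adjoint A) = (\<Sum>a<2. \<Sum>b<2. A $$ (a, b) * cnj (A $$ (a, b)))"
      using A by (simp add: mat_trace_def index_mult_mat_sum[OF A mat_adjoint_carrier[OF A]]
          del: index_mult_mat(1))
    finally show ?thesis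
      by (simp add: complex_mult_cnj cmod_power2)
  qed
  then have "2 * Re (spinor_map A $$ (0, 0)) = (cmod (A $$ (0, 0)))\<^sup>2 + (cmod (A $$ (0, 1)))\<^sup>2 +
      (cmod (A $$ (1, 0)))\<^sup>2 + (cmod (A $$ (1, 1)))\<^sup>2"
    by (simp add: lessThan_2_3_4)
  \<comment> \<open>A vanishing first row would make the determinant zero.\<close>
  moreover have "0 < (cmod (A $$ (0, 0)))\<^sup>2 \<or> 0 < (cmod (A $$ (0, 1)))\<^sup>2"
    using det A by (auto simp: det_mat_2)
  moreover have "0 \<le> (cmod (A $$ (a, b)))\<^sup>2" for a b by simp
  ultimately show ?thesis by (smt (verit))
qed

lemma lorentz_of_proper_orthochronous:
  assumes A: "A \<in> carrier_mat 2 2" and det: "det A \<noteq> 0"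
  defines "L \<equiv> map_mat Re (lorentz_of A)"
  shows "map_mat complex_of_real L = lorentz_of A" "proper_orthochronous_lorentz L"
proof -
  let ?d = "complex_of_real (cmod (det A))" and ?S = "spinor_map A"
  let ?M = "map_mat complex_of_real minkowski"
  have d: "?d \<noteq> 0" using det by simp
  have S: "?S \<in> carrier_mat 4 4" using A by simp
  have M: "?M \<in> carrier_mat 4 4" by simp
  have eq: "lorentz_of A = (1 / ?d) \<cdot>\<^sub>m ?S"
    by (simp add: lorentz_of_def spinor_map_def)
  show of_real: "map_mat complex_of_real L = lorentz_of A"
    unfolding L_def eq using S
    by (intro map_mat_of_real_Re) (auto simp: spinor_map_real[OF A] Reals_divide)
  have L: "L \<in> carrier_mat 4 4" using S by (simp add: L_def eq)
  \<comment> \<open>The relation is proved over the complex numbers and pulled back along the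
    injective embedding of the reals.\<close>
  have "map_mat complex_of_real (L * minkowski * transpose_mat L) =
      lorentz_of A * ?M * transpose_mat (lorentz_of A)"
    unfolding of_real[symmetric] using L
    by (simp add: of_real_hom.mat_hom_mult[of _ 4 4 _ 4] mult_carrier_mat[of _ 4 4 _ 4] map_mat_transpose)
  also have "\<dots> = (1 / ?d * (1 / ?d)) \<cdot>\<^sub>m (?S * ?M * transpose_mat ?S)"
    unfolding eq transpose_smult_mat using S M
    by (simp add: mult_smult_distrib[of _ 4 4 _ 4] mult_smult_assoc_mat[of _ 4 4 _ 4]
        mult_carrier_mat[of _ 4 4 _ 4] smult_smult_mat)
  also have "\<dots> = ?M"
    using d by (simp add: spinor_map_minkowski[OF A] smult_smult_mat power2_eq_square)
  finally have "L * minkowski * transpose_mat L = minkowski"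
    by (rule of_real_hom.mat_hom_inj)
  moreover have "complex_of_real (det L) = 1"
    using d S by (simp add: of_real_hom.hom_det[symmetric] of_real eq det_spinor_map[OF A] power_divide)
  moreover have "0 < L $$ (0, 0)"
    using det S spinor_map_00_pos[OF A det]
    by (simp add: L_def eq Re_divide_of_real)
  ultimately show "proper_orthochronous_lorentz L"
    using L by (simp add: proper_orthochronous_lorentz_def)
qed

section \<open>Positive semidefinite matrices\<close>

lemma mult_mat_vec_adjoint:
  fixes C :: "complex mat"
  assumes C: "C \<in> carrier_mat n m" and u: "u \<in> carrier_vec m" and w: "w \<in> carrier_vec n"
  shows "(C *\<^sub>v u) \<bullet>c w = u \<bullet>c (mat_adjoint C *\<^sub>v w)"
proof -
  have "(C *\<^sub>v u) \<bullet>c w = (\<Sum>i<n. \<Sum>k<m. C $$ (i, k) * u $ k * cnj (w $ i))"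
    using assms by (simp add: scalar_prod_def lessThan_atLeast0 sum_distrib_right)
  also have "\<dots> = (\<Sum>k<m. u $ k * cnj (\<Sum>i<n. cnj (C $$ (i, k)) * w $ i))"
    by (subst sum.swap) (simp add: sum_distrib_left mult_ac)
  also have "\<dots> = u \<bullet>c (mat_adjoint C *\<^sub>v w)"
    using assms by (simp add: scalar_prod_def lessThan_atLeast0)
  finally show ?thesis .
qed

text \<open>The quadratic form of the congruent matrix at \<open>v\<close> is that of
  \<open>X\<close> at C\<dagger> v.\<close>

lemma psd_congruence:
  assumes X: "psd n X" and C: "C \<in> carrier_mat n n"
  shows "psd n (C * X * mat_adjoint C)"
proof -
  have Xc: "X \<in> carrier_mat n n" and Xh: "mat_adjoint X = X"
    and Xp: "\<And>v. v \<in> carrier_vec n \<Longrightarrow> 0 \<le> (X *\<^sub>v v) \<bullet>c v"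
    using X by (auto simp: psd_def)
  have C': "mat_adjoint C \<in> carrier_mat n n" using C by simp
  have CX: "C * X \<in> carrier_mat n n" using C Xc by simp
  have "0 \<le> (C * X * mat_adjoint C *\<^sub>v v) \<bullet>c v" if v: "v \<in> carrier_vec n" for v
  proof -
    have w: "mat_adjoint C *\<^sub>v v \<in> carrier_vec n" using C' v by simp
    have "C * X * mat_adjoint C *\<^sub>v v = C *\<^sub>v (X *\<^sub>v (mat_adjoint C *\<^sub>v v))"
      using assoc_mult_mat_vec[OF CX C' v] assoc_mult_mat_vec[OF C Xc w] by simp
    then show ?thesis
      using mult_mat_vec_adjoint[OF C _ v, of "X *\<^sub>v (mat_adjoint C *\<^sub>v v)"] Xp[OF w] Xc w by simp
  qed
  moreover have "mat_adjoint (C * X * mat_adjoint C) = C * X * mat_adjoint C"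
    using mat_adjoint_mult[OF CX C'] mat_adjoint_mult[OF C Xc] assoc_mult_mat[OF C Xc C'] by (simp add: Xh)
  ultimately show ?thesis
    using C Xc C' by (simp add: psd_def mult_carrier_mat[of _ n n _ n] del: assoc_mult_mat)
qed

text \<open>The test vector is e_i + t e_j, written as a sum so that \<open>i = j\<close> is
  covered; suitable \<open>t\<close> isolate diagonal and off-diagonal entries.\<close>

lemma quadratic_form_two_unit_vecs:
  fixes X :: "complex mat" and t :: complex
  assumes X: "X \<in> carrier_mat n n" and i: "i < n" and j: "j < n"
  defines "v \<equiv> vec n (\<lambda>k. (if k = i then 1 else 0) + (if k = j then t else 0))"
  shows "(X *\<^sub>v v) \<bullet>c v = X $$ (i, i) + t * X $$ (i, j) + cnj t * (X $$ (j, i) + t * X $$ (j, j))"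
proof -
  have Xv: "(X *\<^sub>v v) $ a = X $$ (a, i) + t * X $$ (a, j)" if "a < n" for a
  proof -
    have "(X *\<^sub>v v) $ a = (\<Sum>b<n. X $$ (a, b) * v $ b)"
      using that X by (simp add: v_def scalar_prod_def lessThan_atLeast0)
    also have "\<dots> = (\<Sum>b<n. (if b = i then X $$ (a, b) else 0) + (if b = j then t * X $$ (a, b) else 0))"
      by (intro sum.cong refl) (auto simp: v_def algebra_simps)
    finally show ?thesis
      using i j by (simp add: sum.distrib)
  qed
  have cv: "cnj (v $ a) = (if a = i then 1 else 0) + (if a = j then cnj t else 0)" if "a < n" for a
    using that by (simp add: v_def)
  have "(X *\<^sub>v v) \<bullet>c v = (\<Sum>a<n. (X *\<^sub>v v) $ a * cnj (v $ a))"
    using X by (simp add: v_def scalar_prod_def lessThan_atLeast0)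
  also have "\<dots> = (\<Sum>a<n. (if a = i then X $$ (a, i) + t * X $$ (a, j) else 0) +
      (if a = j then cnj t * (X $$ (a, i) + t * X $$ (a, j)) else 0))"
    by (intro sum.cong refl) (simp add: Xv cv algebra_simps del: index_mult_mat_vec)
  finally show ?thesis
    using i j by (simp add: sum.distrib)
qed

lemma psd_diag_nonneg:
  assumes "psd n X" "i < n"
  shows "0 \<le> X $$ (i, i)"
proof -
  have X: "X \<in> carrier_mat n n"
    and "\<And>v. v \<in> carrier_vec n \<Longrightarrow> 0 \<le> (X *\<^sub>v v) \<bullet>c v"
    using assms(1) by (auto simp: psd_def)
  \<comment> \<open>The case \<open>j = i\<close>, \<open>t = 0\<close>; the zero summand is kept so
    that the formula matches.\<close>
  from this(2)[of "vec n (\<lambda>k. (if k = i then 1 else 0) + (if k = i then 0 else 0))"]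
  show ?thesis
    unfolding quadratic_form_two_unit_vecs[OF X assms(2) assms(2)] by simp
qed

lemma psd_trace_nonneg: "psd n X \<Longrightarrow> 0 \<le> mat_trace X"
  by (auto simp: mat_trace_def psd_diag_nonneg psd_def intro!: sum_nonneg)

lemma psd_trace_eq_0:
  assumes X: "psd n X" and tr: "mat_trace X = 0"
  shows "X = 0\<^sub>m n n"
proof (rule eq_matI)
  have Xc: "X \<in> carrier_mat n n" and Xh: "mat_adjoint X = X"
    and Xp: "\<And>v. v \<in> carrier_vec n \<Longrightarrow> 0 \<le> (X *\<^sub>v v) \<bullet>c v"
    using X by (auto simp: psd_def)
  have diag: "X $$ (i, i) = 0" if "i < n" for i
    using tr that Xc psd_diag_nonneg[OF X]
      sum_nonneg_eq_0_iff[of "{..<n}" "\<lambda>i. X $$ (i, i)"]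
    by (simp add: mat_trace_def)
  fix i j assume "i < dim_row (0\<^sub>m n n :: complex mat)" "j < dim_col (0\<^sub>m n n :: complex mat)"
  then have i: "i < n" and j: "j < n" by auto
  have ji: "X $$ (j, i) = cnj (X $$ (i, j))"
    using mat_adjoint_index(1)[of j X i] Xc i j by (simp add: Xh)
  \<comment> \<open>The diagonal being zero, this choice of \<open>t\<close> makes both cross terms
    equal to minus the squared modulus of the entry, which must therefore vanish.\<close>
  have "0 \<le> - (2 * (X $$ (i, j) * cnj (X $$ (i, j))))"
    using quadratic_form_two_unit_vecs[OF Xc i j, of "- cnj (X $$ (i, j))"]
      Xp[of "vec n (\<lambda>k. (if k = i then 1 else 0) + (if k = j then - cnj (X $$ (i, j)) else 0))"]
    by (simp add: diag i j ji)
  then show "X $$ (i, j) = 0\<^sub>m n n $$ (i, j)"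
    using i j by (simp add: less_eq_complex_def flip: complex_norm_square)
qed (use X in \<open>auto simp: psd_def\<close>)

lemma psd_congruence_trace_pos:
  assumes X: "psd n X" and tr: "mat_trace X \<noteq> 0" and C: "C \<in> carrier_mat n n" and det: "det C \<noteq> 0"
  shows "0 < mat_trace (C * X * mat_adjoint C)"
proof -
  have Xc: "X \<in> carrier_mat n n" using X by (simp add: psd_def)
  \<comment> \<open>\<open>D\<close> is the inverse of \<open>C\<close> in the matrix ring;
    \<open>()\<close> merely fills the extension slot of the ring record.\<close>
  obtain D where D: "D \<in> carrier_mat n n" and DC: "D * C = 1\<^sub>m n"
    using det_non_zero_imp_unit[OF C det, of "()"] by (auto simp: Units_def ring_mat_def)
  have C': "mat_adjoint C \<in> carrier_mat n n" and D': "mat_adjoint D \<in> carrier_mat n n" using C D by auto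
  have one: "mat_adjoint C * mat_adjoint D = 1\<^sub>m n"
    unfolding mat_adjoint_mult[OF D C, symmetric] DC by (rule eq_matI) auto
  have "mat_trace (C * X * mat_adjoint C) \<noteq> 0"
  proof
    assume "mat_trace (C * X * mat_adjoint C) = 0"
    then have zero: "C * X * mat_adjoint C = 0\<^sub>m n n"
      using psd_trace_eq_0[OF psd_congruence[OF X C]] by simp
    \<comment> \<open>Undoing the congruence would force \<open>X\<close> to vanish, against its
      nonzero trace.\<close>
    have "X = (D * C) * X * (mat_adjoint C * mat_adjoint D)"
      using Xc by (simp add: DC one)
    also have "\<dots> = D * (C * X * mat_adjoint C) * mat_adjoint D"
      using Xc C D C' D' by (simp add: assoc_mult_mat[of _ n n _ n _ n] mult_carrier_mat[of _ n n _ n])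
    also have "\<dots> = 0\<^sub>m n n"
      unfolding zero using D D' by simp
    finally show False using tr by (simp add: mat_trace_def)
  qed
  with psd_trace_nonneg[OF psd_congruence[OF X C]] show ?thesis
    by (simp add: less_le)
qed

section \<open>Pauli coefficients of density matrices\<close>

lemma pauli_coeffs_carrier [simp, intro]: "pauli_coeffs \<rho> \<in> carrier_mat 4 4"
  by (simp add: pauli_coeffs_def)

lemma pauli_coeffs_real:
  assumes \<rho>: "\<rho> \<in> carrier_mat 4 4" and h: "mat_adjoint \<rho> = \<rho>" and i: "i < 4" and j: "j < 4"
  shows "pauli_coeffs \<rho> $$ (i, j) \<in> \<real>"
  using mat_trace_hermitian_mult_real[OF \<rho> _ h, of "pauli i \<otimes>\<^sub>K pauli j"] i j
  by (simp add: pauli_coeffs_def mat_adjoint_kron pauli_hermitian Reals_divide)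

lemma pauli_coeffs_smult:
  assumes \<rho>: "\<rho> \<in> carrier_mat 4 4"
  shows "pauli_coeffs (c \<cdot>\<^sub>m \<rho>) = c \<cdot>\<^sub>m pauli_coeffs \<rho>"
proof (rule eq_matI)
  fix i j assume "i < dim_row (c \<cdot>\<^sub>m pauli_coeffs \<rho>)" "j < dim_col (c \<cdot>\<^sub>m pauli_coeffs \<rho>)"
  then have i: "i < 4" and j: "j < 4" by (auto simp: pauli_coeffs_def)
  then have S: "pauli i \<otimes>\<^sub>K pauli j \<in> carrier_mat 4 4" by simp
  show "pauli_coeffs (c \<cdot>\<^sub>m \<rho>) $$ (i, j) = (c \<cdot>\<^sub>m pauli_coeffs \<rho>) $$ (i, j)"
    using i j by (simp add: pauli_coeffs_def mult_smult_assoc_mat[OF \<rho> S]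
        mat_trace_smult[OF mult_carrier_mat[OF \<rho> S]])
qed (auto simp: pauli_coeffs_def)

theorem theorem2:
  fixes \<rho> \<rho>' A B :: "complex mat"
  assumes "two_qubit_density \<rho>"
    and "A \<in> carrier_mat 2 2" and "B \<in> carrier_mat 2 2"
    and "loewner_le 2 (mat_adjoint A * A) (1\<^sub>m 2)"
    and "loewner_le 2 (mat_adjoint B * B) (1\<^sub>m 2)"
    and "det A \<noteq> 0" and "det B \<noteq> 0"
    and "\<rho>' = (1 / mat_trace ((A \<otimes>\<^sub>K B) * \<rho> * mat_adjoint (A \<otimes>\<^sub>K B))) \<cdot>\<^sub>m
               ((A \<otimes>\<^sub>K B) * \<rho> * mat_adjoint (A \<otimes>\<^sub>K B))"
  shows "\<exists>R R' L\<^sub>A L\<^sub>B :: real mat.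
           map_mat complex_of_real R = pauli_coeffs \<rho> \<and>
           map_mat complex_of_real R' = pauli_coeffs \<rho>' \<and>
           map_mat complex_of_real L\<^sub>A = lorentz_of A \<and>
           map_mat complex_of_real L\<^sub>B = lorentz_of B \<and>
           proper_orthochronous_lorentz L\<^sub>A \<and>
           proper_orthochronous_lorentz L\<^sub>B \<and>
           (\<exists>c > 0. R' = c \<cdot>\<^sub>m (L\<^sub>A * R * transpose_mat L\<^sub>B))"
proof -
  let ?C = "A \<otimes>\<^sub>K B"
  let ?\<sigma> = "?C * \<rho> * mat_adjoint ?C"
  let ?t = "mat_trace ?\<sigma>"
  note A = assms(2) and B = assms(3) and dA = \<open>det A \<noteq> 0\<close> and dB = \<open>det B \<noteq> 0\<close>
  have psd: "psd 4 \<rho>" and tr: "mat_trace \<rho> = 1"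
    using assms(1) by (auto simp: two_qubit_density_def)
  have \<rho>: "\<rho> \<in> carrier_mat 4 4" and h: "mat_adjoint \<rho> = \<rho>" using psd by (auto simp: psd_def)
  have C: "?C \<in> carrier_mat 4 4" using A B by simp
  then have \<sigma>: "?\<sigma> \<in> carrier_mat 4 4" using \<rho> by (intro mult_carrier_mat[of _ 4 4]) auto
  have "det ?C \<noteq> 0" using dA dB by (simp add: det_kron_2[OF A B])
  then have "0 < ?t" using psd_congruence_trace_pos[OF psd _ C] tr by simp
  \<comment> \<open>Strict positivity in the order on complex numbers includes being real.\<close>
  then have t: "?t = complex_of_real (Re ?t)" "0 < Re ?t"
    by (auto simp: less_complex_def complex_eq_iff)
  define R where "R = map_mat Re (pauli_coeffs \<rho>)"
  define L\<^sub>A where "L\<^sub>A = map_mat Re (lorentz_of A)"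
  define L\<^sub>B where "L\<^sub>B = map_mat Re (lorentz_of B)"
  \<comment> \<open>The two moduli undo the normalizations in \<open>lorentz_of\<close>, and the
    denominator is the trace normalizing \<open>\<rho>'\<close>.\<close>
  define c where "c = cmod (det A) * cmod (det B) / Re ?t"
  \<comment> \<open>Defined by the desired formula, \<open>R'\<close> is real by construction; what
    remains is that it represents the coefficients of \<open>\<rho>'\<close>.\<close>
  define R' where "R' = c \<cdot>\<^sub>m (L\<^sub>A * R * transpose_mat L\<^sub>B)"
  have R: "map_mat complex_of_real R = pauli_coeffs \<rho>"
    unfolding R_def using carrier_matD[OF pauli_coeffs_carrier]
    by (intro map_mat_of_real_Re) (simp add: pauli_coeffs_real[OF \<rho> h])
  note LA = lorentz_of_proper_orthochronous[OF A dA, folded L\<^sub>A_def]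
  note LB = lorentz_of_proper_orthochronous[OF B dB, folded L\<^sub>B_def]
  have Rc: "R \<in> carrier_mat 4 4" by (simp add: R_def)
  have LAc: "L\<^sub>A \<in> carrier_mat 4 4" and LBc: "L\<^sub>B \<in> carrier_mat 4 4"
    using LA(2) LB(2) by (auto simp: proper_orthochronous_lorentz_def)
  have c: "0 < c" using t(2) dA dB by (simp add: c_def)
  have spinor: "spinor_map X = complex_of_real (cmod (det X)) \<cdot>\<^sub>m lorentz_of X" if "det X \<noteq> 0" for X
    using that by (simp add: lorentz_of_def spinor_map_def smult_smult_mat)
  have l: "lorentz_of A \<in> carrier_mat 4 4" "lorentz_of B \<in> carrier_mat 4 4"
    using LAc LBc by (auto simp flip: LA(1) LB(1))
  have "pauli_coeffs \<rho>' = (1 / ?t) \<cdot>\<^sub>m (spinor_map A * pauli_coeffs \<rho> * transpose_mat (spinor_map B))"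
    unfolding assms(8) pauli_coeffs_smult[OF \<sigma>] pauli_coeffs_conjugation[OF \<rho> A B] ..
  also have "\<dots> = (1 / ?t * (complex_of_real (cmod (det A)) * complex_of_real (cmod (det B)))) \<cdot>\<^sub>m
      (lorentz_of A * pauli_coeffs \<rho> * transpose_mat (lorentz_of B))"
    unfolding spinor[OF dA] spinor[OF dB] transpose_smult_mat using l
    by (simp add: mult_smult_distrib[of _ 4 4 _ 4] mult_smult_assoc_mat[of _ 4 4 _ 4]
        mult_carrier_mat[of _ 4 4 _ 4] smult_smult_mat mult_ac)
  also have "1 / ?t * (complex_of_real (cmod (det A)) * complex_of_real (cmod (det B))) = complex_of_real c"
    by (subst t(1)) (simp add: c_def)
  also have "complex_of_real c \<cdot>\<^sub>m (lorentz_of A * pauli_coeffs \<rho> * transpose_mat (lorentz_of B)) =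
      map_mat complex_of_real R'"
    unfolding R'_def R[symmetric] LA(1)[symmetric] LB(1)[symmetric] using Rc LAc LBc
    by (simp add: of_real_hom.mat_hom_mult[of _ 4 4 _ 4] mult_carrier_mat[of _ 4 4 _ 4]
        map_mat_transpose map_mat_of_real_smult)
  finally have "map_mat complex_of_real R' = pauli_coeffs \<rho>'" ..
  with R LA LB c R'_def show ?thesis by blast
qed

end
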